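(* For every $n\in\mathbb{N}$, we have $s(n)\le b(n)$, where $s(n)$ is the minimum number such that every temporal clique with $n$ vertices admits a spanner with at most $s(n)$ edges, and $b(n)$ is the minimum number such that every temporal bi-clique with $n$ vertices on each side admits a bi-spanner with at most $b(n)$ edges.
   Context: A temporal graph is $(V,E,\lambda)$ with $\lambda\colon E\to\mathbb{N}$. A path $v_1\dots v_k$ is temporal if $\lambda(\{v_i,v_{i+1}\})\le\lambda(\{v_{i+1},v_{i+2}\})$ for all $i\in[k-2]$. A temporal clique has a complete underlying graph; a spanner is an edge set $S$ such that every vertex reaches every other vertex by a temporal path within $S$. A temporal bi-clique $(A,B,\lambda)$ has the complete bipartite graph with disjoint parts $A,B$ as underlying graph; a bi-spanner is an edge set $S$ such that every $a\in A$ reaches every $b\in B$ by a temporal path within $S$. *)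

theory Defs
  imports Main
begin

record 'a tgraph =
  verts :: "'a set"
  edges :: "'a set set"
  label :: "'a set \<Rightarrow> nat"  \<comment> \<open>only the values on \<open>edges\<close> are relevant\<close>

definition complete_edges :: "'a set \<Rightarrow> 'a set set" where
  "complete_edges V = {{u, v} |u v. u \<in> V \<and> v \<in> V \<and> u \<noteq> v}"

definition complete_bipartite_edges :: "'a set \<Rightarrow> 'a set \<Rightarrow> 'a set set" where
  "complete_bipartite_edges A B = {{a, b} |a b. a \<in> A \<and> b \<in> B}"

definition temporal_graph :: "'a tgraph \<Rightarrow> bool" where
  "temporal_graph G \<longleftrightarrow> finite (verts G) \<and> edges G \<subseteq> complete_edges (verts G)"

definition path_within :: "'a tgraph \<Rightarrow> 'a set set \<Rightarrow> 'a list \<Rightarrow> bool" where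
  "path_within G S vs \<longleftrightarrow>
     vs \<noteq> [] \<and> distinct vs \<and> set vs \<subseteq> verts G \<and>
     (\<forall>i. Suc i < length vs \<longrightarrow> {vs ! i, vs ! Suc i} \<in> S)"

definition temporal :: "'a tgraph \<Rightarrow> 'a list \<Rightarrow> bool" where
  "temporal G vs \<longleftrightarrow>
     (\<forall>i. i + 2 < length vs \<longrightarrow>
        label G {vs ! i, vs ! (i + 1)} \<le> label G {vs ! (i + 1), vs ! (i + 2)})"

definition reaches_within :: "'a tgraph \<Rightarrow> 'a set set \<Rightarrow> 'a \<Rightarrow> 'a \<Rightarrow> bool" where
  "reaches_within G S u v \<longleftrightarrow>
     (\<exists>vs. path_within G S vs \<and> temporal G vs \<and> hd vs = u \<and> last vs = v)"

definition temporal_clique :: "'a tgraph \<Rightarrow> bool" where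
  "temporal_clique G \<longleftrightarrow> temporal_graph G \<and> edges G = complete_edges (verts G)"

definition spanner :: "'a tgraph \<Rightarrow> 'a set set \<Rightarrow> bool" where
  "spanner G S \<longleftrightarrow>
     S \<subseteq> edges G \<and> (\<forall>u\<in>verts G. \<forall>v\<in>verts G. u \<noteq> v \<longrightarrow> reaches_within G S u v)"

definition temporal_biclique :: "'a set \<Rightarrow> 'a set \<Rightarrow> 'a tgraph \<Rightarrow> bool" where
  "temporal_biclique A B G \<longleftrightarrow>
     temporal_graph G \<and> A \<inter> B = {} \<and> verts G = A \<union> B \<and>
     edges G = complete_bipartite_edges A B"

definition bi_spanner :: "'a set \<Rightarrow> 'a set \<Rightarrow> 'a tgraph \<Rightarrow> 'a set set \<Rightarrow> bool" where
  "bi_spanner A B G S \<longleftrightarrow>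
     S \<subseteq> edges G \<and> (\<forall>a\<in>A. \<forall>b\<in>B. reaches_within G S a b)"

text \<open>
  Vertices are taken from \<^typ>\<open>nat\<close>, which loses no generality: every finite graph is
  isomorphic to one on natural numbers; see \<open>clique_spanner_any_type\<close> and
  \<open>biclique_bi_spanner_any_type\<close> below.
\<close>

definition spanner_number :: "nat \<Rightarrow> nat" where
  "spanner_number n =
     (LEAST m. \<forall>G :: nat tgraph. temporal_clique G \<and> card (verts G) = n \<longrightarrow>
        (\<exists>S. spanner G S \<and> card S \<le> m))"

definition bi_spanner_number :: "nat \<Rightarrow> nat" where
  "bi_spanner_number n =
     (LEAST m. \<forall>A B. \<forall>G :: nat tgraph.
        temporal_biclique A B G \<and> card A = n \<and> card B = n \<longrightarrow>
        (\<exists>S. bi_spanner A B G S \<and> card S \<le> m))"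


subsection \<open>The minima exist and do not depend on the vertex type\<close>

lemma complete_edges_Pow: "complete_edges V \<subseteq> Pow V"
  by (auto simp: complete_edges_def)

lemma card_edges_le:
  assumes "temporal_graph G" shows "card (edges G) \<le> 2 ^ card (verts G)"
proof -
  have "edges G \<subseteq> Pow (verts G)" "finite (verts G)"
    using assms complete_edges_Pow by (auto simp: temporal_graph_def)
  then show ?thesis by (metis card_Pow card_mono finite_Pow_iff)
qed

lemma reaches_within_edge:
  assumes "{u, v} \<in> S" "u \<noteq> v" "u \<in> verts G" "v \<in> verts G"
  shows "reaches_within G S u v"
  unfolding reaches_within_def
  by (rule exI[of _ "[u, v]"]) (use assms in \<open>auto simp: path_within_def temporal_def\<close>)

lemma spanner_edges: "temporal_clique G \<Longrightarrow> spanner G (edges G)"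
  by (auto simp: spanner_def temporal_clique_def complete_edges_def intro!: reaches_within_edge)

lemma bi_spanner_edges: "temporal_biclique A B G \<Longrightarrow> bi_spanner A B G (edges G)"
  by (auto simp: bi_spanner_def temporal_biclique_def complete_bipartite_edges_def
      intro!: reaches_within_edge)

lemma spanner_number_bound:
  fixes G :: "nat tgraph"
  assumes "temporal_clique G"
  shows "\<exists>S. spanner G S \<and> card S \<le> spanner_number (card (verts G))"
proof -
  let ?P = "\<lambda>m. \<forall>H :: nat tgraph. temporal_clique H \<and> card (verts H) = card (verts G) \<longrightarrow>
                  (\<exists>S. spanner H S \<and> card S \<le> m)"
  have "?P (2 ^ card (verts G))"
    by (metis spanner_edges card_edges_le temporal_clique_def)
  then have "?P (LEAST m. ?P m)" by (rule LeastI)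
  then show ?thesis using assms by (simp add: spanner_number_def)
qed

lemma bi_spanner_number_bound:
  fixes G :: "nat tgraph"
  assumes "temporal_biclique A B G" "card A = n" "card B = n"
  shows "\<exists>S. bi_spanner A B G S \<and> card S \<le> bi_spanner_number n"
proof -
  let ?P = "\<lambda>m. \<forall>A B. \<forall>G :: nat tgraph. temporal_biclique A B G \<and> card A = n \<and> card B = n \<longrightarrow>
                  (\<exists>S. bi_spanner A B G S \<and> card S \<le> m)"
  have "?P (2 ^ (n + n))"
  proof (intro allI impI)
    fix A B and G :: "nat tgraph"
    assume *: "temporal_biclique A B G \<and> card A = n \<and> card B = n"
    then have "temporal_graph G" "card (verts G) = n + n"
      by (auto simp: temporal_biclique_def temporal_graph_def card_Un_disjoint)
    then show "\<exists>S. bi_spanner A B G S \<and> card S \<le> 2 ^ (n + n)"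
      using * bi_spanner_edges card_edges_le by metis
  qed
  then have "?P (LEAST m. ?P m)" by (rule LeastI)
  then show ?thesis using assms by (simp add: bi_spanner_number_def)
qed

definition relabel :: "('a \<Rightarrow> 'b) \<Rightarrow> ('b \<Rightarrow> 'a) \<Rightarrow> 'a tgraph \<Rightarrow> 'b tgraph" where
  "relabel f g G = \<lparr>verts = f ` verts G, edges = (`) f ` edges G, label = (\<lambda>e. label G (g ` e))\<rparr>"

lemma image_complete_edges:
  "inj_on f V \<Longrightarrow> (`) f ` complete_edges V = complete_edges (f ` V)"
  unfolding complete_edges_def inj_on_def by (auto simp: image_def)

lemma image_complete_bipartite_edges:
  "(`) f ` complete_bipartite_edges A B = complete_bipartite_edges (f ` A) (f ` B)"
  unfolding complete_bipartite_edges_def by (auto simp: image_def)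

lemma temporal_graph_relabel:
  assumes "inj_on f (verts G)" "temporal_graph G"
  shows "temporal_graph (relabel f g G)"
  using assms image_mono[of "edges G" "complete_edges (verts G)" "(`) f"]
  by (auto simp: temporal_graph_def relabel_def image_complete_edges)

lemma reaches_within_relabel:
  assumes inv: "\<And>x. x \<in> verts G \<Longrightarrow> g (f x) = x"
    and "reaches_within (relabel f g G) S u v"
  shows "reaches_within G ((`) g ` S) (g u) (g v)"
proof -
  obtain vs where vs: "vs \<noteq> []" "distinct vs" "set vs \<subseteq> f ` verts G"
    "\<forall>i. Suc i < length vs \<longrightarrow> {vs ! i, vs ! Suc i} \<in> S"
    "temporal (relabel f g G) vs" "hd vs = u" "last vs = v"
    using assms(2) by (auto simp: reaches_within_def path_within_def relabel_def)
  have "inj_on g (f ` verts G)" using inv by (auto simp: inj_on_def)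
  then have "distinct (map g vs)"
    using vs(2,3) by (simp add: distinct_map inj_on_subset)
  moreover have "set (map g vs) \<subseteq> verts G" using vs(3) inv by auto
  moreover have "{map g vs ! i, map g vs ! Suc i} \<in> (`) g ` S" if "Suc i < length vs" for i
    using vs(4) that by (auto simp: image_iff intro!: bexI[of _ "{vs ! i, vs ! Suc i}"])
  moreover have "temporal G (map g vs)"
    using vs(5) by (auto simp: temporal_def relabel_def)
  ultimately show ?thesis
    unfolding reaches_within_def path_within_def using vs(1,6,7)
    by (intro exI[of _ "map g vs"]) (auto simp: hd_map last_map)
qed

lemma relabel_subset:
  assumes inv: "\<And>x. x \<in> verts G \<Longrightarrow> g (f x) = x"
    and "temporal_graph G" "S \<subseteq> edges (relabel f g G)"
  shows "(`) g ` S \<subseteq> edges G"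
proof -
  have "g ` f ` e = e" if "e \<in> edges G" for e
  proof -
    have "e \<subseteq> verts G" using that assms(2) complete_edges_Pow by (auto simp: temporal_graph_def)
    then show ?thesis using inv by (force simp: image_image)
  qed
  then show ?thesis using assms(3) by (auto simp: relabel_def)
qed

lemma finite_nat_coding:
  assumes "finite (V :: 'a set)"
  obtains f :: "'a \<Rightarrow> nat" and g where "\<And>x. x \<in> V \<Longrightarrow> g (f x) = x" "inj_on f V"
  using finite_imp_inj_to_nat_seg[OF assms] by (metis inv_into_f_f)

lemma finite_spanner: "temporal_graph G \<Longrightarrow> S \<subseteq> edges G \<Longrightarrow> finite S"
  by (metis complete_edges_Pow finite_Pow_iff finite_subset temporal_graph_def)

lemma clique_spanner_any_type:
  fixes G :: "'a tgraph"
  assumes G: "temporal_clique G" and n: "card (verts G) = n"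
  shows "\<exists>S. spanner G S \<and> card S \<le> spanner_number n"
proof -
  have tg: "temporal_graph G" using G by (simp add: temporal_clique_def)
  then have "finite (verts G)" by (simp add: temporal_graph_def)
  then obtain f :: "'a \<Rightarrow> nat" and g
    where inv: "\<And>x. x \<in> verts G \<Longrightarrow> g (f x) = x" and inj: "inj_on f (verts G)"
    by (rule finite_nat_coding) blast
  let ?H = "relabel f g G"
  have tH: "temporal_graph ?H" by (rule temporal_graph_relabel[OF inj tg])
  have "temporal_clique ?H"
    using tH G inj by (simp add: temporal_clique_def relabel_def image_complete_edges)
  moreover have "card (verts ?H) = n" using inj n by (simp add: relabel_def card_image)
  ultimately obtain S where S: "spanner ?H S" "card S \<le> spanner_number n"
    using spanner_number_bound by blast
  have sub: "S \<subseteq> edges ?H" using S(1) by (simp add: spanner_def)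
  have "reaches_within G ((`) g ` S) u v" if "u \<in> verts G" "v \<in> verts G" "u \<noteq> v" for u v
  proof -
    have "reaches_within ?H S (f u) (f v)"
      using S(1) that inj_on_eq_iff[OF inj] by (simp add: spanner_def relabel_def)
    from reaches_within_relabel[OF inv this] show ?thesis using inv that by simp
  qed
  then have "spanner G ((`) g ` S)"
    using relabel_subset[OF inv tg sub] by (simp add: spanner_def)
  moreover have "card ((`) g ` S) \<le> spanner_number n"
    using S(2) card_image_le[OF finite_spanner[OF tH sub]] le_trans by blast
  ultimately show ?thesis by blast
qed

lemma biclique_bi_spanner_any_type:
  fixes G :: "'a tgraph"
  assumes G: "temporal_biclique A B G" and n: "card A = n" "card B = n"
  shows "\<exists>S. bi_spanner A B G S \<and> card S \<le> bi_spanner_number n"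
proof -
  have tg: "temporal_graph G" and V: "verts G = A \<union> B" and AB: "A \<inter> B = {}"
    using G by (simp_all add: temporal_biclique_def)
  then have "finite (verts G)" by (simp add: temporal_graph_def)
  then obtain f :: "'a \<Rightarrow> nat" and g
    where inv: "\<And>x. x \<in> verts G \<Longrightarrow> g (f x) = x" and inj: "inj_on f (verts G)"
    by (rule finite_nat_coding) blast
  let ?H = "relabel f g G"
  have tH: "temporal_graph ?H" by (rule temporal_graph_relabel[OF inj tg])
  have "f ` A \<inter> f ` B = {}"
    using inj AB V by (metis Un_upper1 Un_upper2 image_empty inj_on_image_Int)
  then have "temporal_biclique (f ` A) (f ` B) ?H"
    using tH G
    by (simp add: temporal_biclique_def relabel_def image_complete_bipartite_edges image_Un)
  moreover have "card (f ` A) = n" "card (f ` B) = n"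
    using inj n V by (metis Un_upper1 Un_upper2 card_image inj_on_subset)+
  ultimately obtain S where S: "bi_spanner (f ` A) (f ` B) ?H S" "card S \<le> bi_spanner_number n"
    using bi_spanner_number_bound by blast
  have sub: "S \<subseteq> edges ?H" using S(1) by (simp add: bi_spanner_def)
  have "reaches_within G ((`) g ` S) x y" if "x \<in> A" "y \<in> B" for x y
  proof -
    have "reaches_within ?H S (f x) (f y)" using S(1) that by (auto simp: bi_spanner_def)
    from reaches_within_relabel[OF inv this] show ?thesis using inv that V by simp
  qed
  then have "bi_spanner A B G ((`) g ` S)"
    using relabel_subset[OF inv tg sub] by (simp add: bi_spanner_def)
  moreover have "card ((`) g ` S) \<le> bi_spanner_number n"
    using S(2) card_image_le[OF finite_spanner[OF tH sub]] le_trans by blast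
  ultimately show ?thesis by blast
qed

end

theory Submission imports Defs begin

text \<open>
  Split every vertex \<open>v\<close> of a temporal clique into \<open>(v, False)\<close> and \<open>(v, True)\<close>, and let the edge
  between \<open>(u, False)\<close> and \<open>(v, True)\<close> inherit the label of \<open>{u, v}\<close>. A temporal path from
  \<open>(u, False)\<close> to \<open>(v, True)\<close> in a bi-spanner of the resulting bi-clique projects to a walk from \<open>u\<close>
  to \<open>v\<close> with non-decreasing labels once the collapsed edges \<open>{(w, False), (w, True)}\<close> are dropped,
  and cutting out closed subwalks turns it into a temporal path. So the projection of the bi-spanner
  is a spanner, with no more edges.
\<close>

text \<open>The recursive form, with repeated vertices allowed, makes walks amenable to list
  induction. The threshold \<open>t\<close> carries the label of the edge just traversed; it bounds
  the first label from below, hence all of them.\<close>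

fun journey :: "('a set \<Rightarrow> nat) \<Rightarrow> 'a set set \<Rightarrow> nat \<Rightarrow> 'a list \<Rightarrow> bool" where
  "journey f S t [] \<longleftrightarrow> False"
| "journey f S t [v] \<longleftrightarrow> True"
| "journey f S t (u # v # vs) \<longleftrightarrow> {u, v} \<in> S \<and> t \<le> f {u, v} \<and> journey f S (f {u, v}) (v # vs)"

lemma journey_mono: "journey f S t vs \<Longrightarrow> s \<le> t \<Longrightarrow> journey f S s vs"
  by (induction f S t vs rule: journey.induct) auto

text \<open>Labels never decrease along a journey, so the threshold \<open>t\<close> survives
  cutting off an initial segment.\<close>

lemma journey_suffix: "journey f S t (us @ v # vs) \<Longrightarrow> journey f S t (v # vs)"
proof (induction us arbitrary: t)
  case (Cons u us)
  then show ?case by (cases us) (auto intro: journey_mono)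
qed simp

lemma journey_iff:
  "journey (label G) S t vs \<longleftrightarrow>
     vs \<noteq> [] \<and> (\<forall>i. Suc i < length vs \<longrightarrow> {vs ! i, vs ! Suc i} \<in> S) \<and> temporal G vs \<and>
     (1 < length vs \<longrightarrow> t \<le> label G {vs ! 0, vs ! 1})"
proof (induction "label G" S t vs rule: journey.induct)
  case (3 S t u v vs)
  \<comment> \<open>Splitting off index 0 makes the indexed conditions unfold in step with the
    recursion of \<open>journey\<close>.\<close>
  have all_nat: "(\<forall>i. P i) \<longleftrightarrow> P 0 \<and> (\<forall>i. P (Suc i))" for P
    by (metis not0_implies_Suc)
  have "temporal G (u # v # vs) \<longleftrightarrow>
      temporal G (v # vs) \<and> (vs \<noteq> [] \<longrightarrow> label G {u, v} \<le> label G {v, vs ! 0})"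
    unfolding temporal_def by (subst all_nat) auto
  moreover have "(\<forall>i. Suc i < length (u # v # vs) \<longrightarrow>
                     {(u # v # vs) ! i, (u # v # vs) ! Suc i} \<in> S) \<longleftrightarrow>
      {u, v} \<in> S \<and> (\<forall>i. Suc i < length (v # vs) \<longrightarrow> {(v # vs) ! i, (v # vs) ! Suc i} \<in> S)"
    by (subst all_nat) simp
  ultimately show ?case using 3 by auto
qed (auto simp: temporal_def)

lemma reaches_within_iff_journey:
  "reaches_within G S u v \<longleftrightarrow>
     (\<exists>vs. journey (label G) S 0 vs \<and> distinct vs \<and> set vs \<subseteq> verts G \<and> hd vs = u \<and> last vs = v)"
  by (auto simp: reaches_within_def path_within_def journey_iff)

text \<open>The path is built from the back: once the tail projects to a path \<open>ps\<close>,
  either \<open>p u\<close> already lies on \<open>ps\<close> and everything before it is cut, or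
  \<open>p u\<close> is prepended. Collapsed edges fall under the first case, since then
  \<open>p u\<close> is the head of \<open>ps\<close>.\<close>

lemma journey_project:
  assumes "journey f S t vs"
    and edge: "\<And>x y. {x, y} \<in> S \<Longrightarrow> p x \<noteq> p y \<Longrightarrow> {p x, p y} \<in> T"
    and lab: "\<And>x y. f {x, y} = g {p x, p y}"
  shows "\<exists>ps. journey g T t ps \<and> distinct ps \<and> set ps \<subseteq> p ` set vs \<and>
              hd ps = p (hd vs) \<and> last ps = p (last vs)"
  using assms(1)
proof (induction vs arbitrary: t)
  case (Cons u vs)
  show ?case
  proof (cases vs)
    case Nil
    then show ?thesis by (intro exI[of _ "[p u]"]) simp
  next
    case (Cons v ws)
    let ?s = "g {p u, p v}"
    have uv: "{u, v} \<in> S" and t: "t \<le> ?s" and "journey f S ?s vs"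
      using Cons.prems Cons by (auto simp: lab)
    then obtain ps where ps: "journey g T ?s ps" "distinct ps" "set ps \<subseteq> p ` set vs"
        "hd ps = p v" "last ps = p (last vs)"
      using Cons.IH[of ?s] Cons by auto
    show ?thesis
    proof (cases "p u \<in> set ps")
      case True
      then obtain qs rs where qs: "ps = qs @ p u # rs" by (meson split_list)
      \<comment> \<open>The suffix has threshold \<open>?s\<close>, which may be lowered to
        \<open>t\<close>.\<close>
      then have "journey g T t (p u # rs)"
        using journey_mono[OF journey_suffix t] ps(1) by simp
      then show ?thesis
        using ps(2,3,5) qs Cons by (intro exI[of _ "p u # rs"]) auto
    next
      case False
      obtain rs where rs: "ps = p v # rs"
        using ps(1,4) by (cases ps) auto
      then have "{p u, p v} \<in> T" using edge uv False by auto
      then show ?thesis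
        using ps t Cons rs False by (intro exI[of _ "p u # ps"]) auto
    qed
  qed
qed simp

text \<open>The edge joining the two copies of \<open>w\<close> gets the label of
  \<open>{w}\<close>, which is no edge of a temporal graph. Any value would do: removing an entry
  from a non-decreasing sequence of labels keeps it non-decreasing.\<close>

definition double_cover :: "'a tgraph \<Rightarrow> ('a \<times> bool) tgraph" where
  "double_cover G =
     \<lparr>verts = verts G \<times> UNIV,
      edges = complete_bipartite_edges (verts G \<times> {False}) (verts G \<times> {True}),
      label = (\<lambda>e. label G (fst ` e))\<rparr>"

lemma temporal_biclique_double_cover:
  assumes "finite (verts G)"
  shows "temporal_biclique (verts G \<times> {False}) (verts G \<times> {True}) (double_cover G)"
proof -
  have "complete_bipartite_edges (verts G \<times> {False}) (verts G \<times> {True})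
          \<subseteq> complete_edges (verts G \<times> UNIV)"
    unfolding complete_bipartite_edges_def complete_edges_def by (intro Collect_mono) blast
  then show ?thesis
    using assms
    by (auto simp: temporal_biclique_def temporal_graph_def double_cover_def)
qed

text \<open>Every vertex has a copy on each side, so reaching from left to right covers all ordered
  pairs. Intersecting with \<open>edges G\<close> discards the singletons \<open>{w}\<close> left by
  collapsed edges.\<close>

lemma spanner_of_bi_spanner_double_cover:
  assumes G: "temporal_clique G"
    and S: "bi_spanner (verts G \<times> {False}) (verts G \<times> {True}) (double_cover G) S"
  shows "spanner G ((`) fst ` S \<inter> edges G)"
proof -
  have E: "edges G = complete_edges (verts G)" using G by (simp add: temporal_clique_def)
  have SE: "S \<subseteq> complete_bipartite_edges (verts G \<times> {False}) (verts G \<times> {True})"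
    using S by (simp add: bi_spanner_def double_cover_def)
  have edge: "{fst x, fst y} \<in> (`) fst ` S \<inter> edges G" if "{x, y} \<in> S" "fst x \<noteq> fst y" for x y
  proof
    show "{fst x, fst y} \<in> (`) fst ` S" using that(1) by (rule rev_image_eqI) simp
    have "{x, y} \<subseteq> verts G \<times> UNIV"
      using subsetD[OF SE that(1)] by (auto simp: complete_bipartite_edges_def)
    then have "fst x \<in> verts G" "fst y \<in> verts G" by auto
    then show "{fst x, fst y} \<in> edges G"
      using that(2) by (auto simp: E complete_edges_def)
  qed
  have "reaches_within G ((`) fst ` S \<inter> edges G) u v" if uv: "u \<in> verts G" "v \<in> verts G" for u v
  proof -
    have "reaches_within (double_cover G) S (u, False) (v, True)"
      using S uv by (auto simp: bi_spanner_def)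
    then obtain vs where vs: "journey (label (double_cover G)) S 0 vs" "set vs \<subseteq> verts G \<times> UNIV"
        "hd vs = (u, False)" "last vs = (v, True)"
      by (auto simp: reaches_within_iff_journey double_cover_def)
    have "\<exists>ps. journey (label G) ((`) fst ` S \<inter> edges G) 0 ps \<and> distinct ps \<and>
            set ps \<subseteq> fst ` set vs \<and> hd ps = fst (hd vs) \<and> last ps = fst (last vs)"
      by (rule journey_project[OF vs(1) edge]) (auto simp: double_cover_def)
    then obtain ps where "journey (label G) ((`) fst ` S \<inter> edges G) 0 ps" "distinct ps"
        "set ps \<subseteq> fst ` set vs" "hd ps = fst (hd vs)" "last ps = fst (last vs)"
      by blast
    moreover have "fst ` set vs \<subseteq> verts G" using vs(2) by auto
    ultimately show ?thesis
      unfolding reaches_within_iff_journey using vs(3,4) by (intro exI[of _ ps]) auto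
  qed
  then show ?thesis by (simp add: spanner_def)
qed

theorem theorem6:
  fixes n :: nat
  shows "spanner_number n \<le> bi_spanner_number n"
  unfolding spanner_number_def
proof (rule Least_le, intro allI impI)
  fix G :: "nat tgraph"
  assume "temporal_clique G \<and> card (verts G) = n"
  then have G: "temporal_clique G" and n: "card (verts G) = n" and fin: "finite (verts G)"
    by (auto simp: temporal_clique_def temporal_graph_def)
  let ?A = "verts G \<times> {False}" and ?B = "verts G \<times> {True}"
  have bc: "temporal_biclique ?A ?B (double_cover G)"
    using fin by (rule temporal_biclique_double_cover)
  moreover have "card ?A = n" "card ?B = n" using n by (simp_all add: card_cartesian_product)
  \<comment> \<open>The cover has pairs as vertices, whereas \<open>bi_spanner_number\<close>
    quantifies over graphs on \<open>nat\<close>; hence the version for any vertex type.\<close>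
  ultimately obtain S where S: "bi_spanner ?A ?B (double_cover G) S"
      and card: "card S \<le> bi_spanner_number n"
    using biclique_bi_spanner_any_type by blast
  \<comment> \<open>An infinite set would have \<open>card\<close> 0, so the image bound needs
    finiteness.\<close>
  have "finite S"
    using S bc finite_spanner[of "double_cover G" S]
    by (simp add: bi_spanner_def temporal_biclique_def)
  then have "card ((`) fst ` S \<inter> edges G) \<le> card S"
    by (meson Int_lower1 card_image_le card_mono finite_imageI le_trans)
  then show "\<exists>S. spanner G S \<and> card S \<le> bi_spanner_number n"
    using spanner_of_bi_spanner_double_cover[OF G S] card le_trans by blast
qed

end
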